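(* Let $a,b,p,q\in\mathbb{Z}$, let $(w_n)_{n\ge 0}$ be the Horadam sequence $w_0=a$, $w_1=b$, $w_n=p\,w_{n-1}+q\,w_{n-2}$ for $n\ge 2$, and let $BH_n=w_n+w_{n+1}i+w_{n+2}j+w_{n+3}k\in\mathbb{BC}$ be the $n$th bicomplex Horadam number. Let $\alpha=\frac{p+\sqrt{p^2+4q}}{2}$ and $\beta=\frac{p-\sqrt{p^2+4q}}{2}$ be the roots of $t^2-pt-q=0$, and set $A=b-a\beta$, $B=b-a\alpha$, $\underline{\alpha}=1+\alpha i+\alpha^2 j+\alpha^3 k$, $\underline{\beta}=1+\beta i+\beta^2 j+\beta^3 k$. Then for every integer $n\ge 1$, $$BH_n^2-BH_{n+1}BH_{n-1}=AB\,\underline{\alpha}\,\underline{\beta}\,(-q)^{n-1}.$$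
   Context: $\mathbb{BC}=\{z_1+z_2 j : z_1,z_2\in\mathbb{C}\}$ is the algebra of bicomplex numbers: the commutative associative real algebra with basis $1,i,j,k$, where $i^2=j^2=-1$, $ij=ji=k$, $k^2=1$, $ik=ki=-j$, $jk=kj=-i$. Here $\mathbb{C}=\{x+yi : x,y\in\mathbb{R}\}\subset\mathbb{BC}$; if $p^2+4q<0$ the roots $\alpha,\beta$ are regarded as elements of this copy of $\mathbb{C}$ (with a fixed choice of the square root). Convention: $0^0=1$. *)

theory Defs imports Complex_Main begin

(* Bicomplex z1 z2 stands for z1 + z2 j with j^2 = -1. *)
datatype bicomplex = Bicomplex (bc_fst: complex) (bc_snd: complex)

lemma bicomplex_eq_iff: "x = y \<longleftrightarrow> bc_fst x = bc_fst y \<and> bc_snd x = bc_snd y"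
  by (cases x; cases y) simp

instantiation bicomplex :: "{comm_ring_1, real_algebra_1}"
begin

definition "0 = Bicomplex 0 0"
definition "1 = Bicomplex 1 0"
definition "x + y = Bicomplex (bc_fst x + bc_fst y) (bc_snd x + bc_snd y)"
definition "- x = Bicomplex (- bc_fst x) (- bc_snd x)"
definition "x - y = Bicomplex (bc_fst x - bc_fst y) (bc_snd x - bc_snd y)"
definition "x * y = Bicomplex (bc_fst x * bc_fst y - bc_snd x * bc_snd y)
                              (bc_fst x * bc_snd y + bc_snd x * bc_fst y)"
definition "r *\<^sub>R x = Bicomplex (r *\<^sub>R bc_fst x) (r *\<^sub>R bc_snd x)"

lemmas bicomplex_defs = zero_bicomplex_def one_bicomplex_def plus_bicomplex_def
  uminus_bicomplex_def minus_bicomplex_def times_bicomplex_def scaleR_bicomplex_def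

instance
  by standard (simp_all add: bicomplex_defs algebra_simps)

end

definition of_complex :: "complex \<Rightarrow> bicomplex" where
  "of_complex z = Bicomplex z 0"

definition bc_i :: bicomplex where "bc_i = Bicomplex \<i> 0"
definition bc_j :: bicomplex where "bc_j = Bicomplex 0 1"
definition bc_k :: bicomplex where "bc_k = Bicomplex 0 \<i>"

lemmas bc_unit_defs = bc_i_def bc_j_def bc_k_def

lemma bc_unit_mult:
  "bc_i * bc_i = -1" "bc_j * bc_j = -1" "bc_k * bc_k = 1"
  "bc_i * bc_j = bc_k" "bc_j * bc_i = bc_k"
  "bc_i * bc_k = - bc_j" "bc_k * bc_i = - bc_j"
  "bc_j * bc_k = - bc_i" "bc_k * bc_j = - bc_i"
  by (simp_all add: bc_unit_defs bicomplex_defs)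

lemma Bicomplex_conv: "Bicomplex z1 z2 = of_complex z1 + of_complex z2 * bc_j"
  by (simp add: of_complex_def bc_unit_defs bicomplex_defs)

lemma of_complex_Complex: "of_complex (Complex x y) = of_real x + of_real y * bc_i"
  by (simp add: of_complex_def of_real_def bc_unit_defs bicomplex_defs complex_eq_iff)

lemma of_complex_hom [simp]:
  "of_complex 0 = 0" "of_complex 1 = 1"
  "of_complex (x + y) = of_complex x + of_complex y"
  "of_complex (x - y) = of_complex x - of_complex y"
  "of_complex (- x) = - of_complex x"
  "of_complex (x * y) = of_complex x * of_complex y"
  by (simp_all add: of_complex_def bicomplex_defs)

lemma bicomplex_basis:
  "\<exists>!(x0, x1, x2, x3). z = of_real x0 + of_real x1 * bc_i + of_real x2 * bc_j + of_real x3 * bc_k"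
proof -
  have "z = of_real x0 + of_real x1 * bc_i + of_real x2 * bc_j + of_real x3 * bc_k \<longleftrightarrow>
     x0 = Re (bc_fst z) \<and> x1 = Im (bc_fst z) \<and> x2 = Re (bc_snd z) \<and> x3 = Im (bc_snd z)"
    for x0 x1 x2 x3
    by (auto simp: of_real_def bc_unit_defs bicomplex_defs bicomplex_eq_iff complex_eq_iff)
  then show ?thesis by auto
qed

fun horadam :: "int \<Rightarrow> int \<Rightarrow> int \<Rightarrow> int \<Rightarrow> nat \<Rightarrow> int" where
  "horadam a b p q 0 = a"
| "horadam a b p q (Suc 0) = b"
| "horadam a b p q (Suc (Suc n)) = p * horadam a b p q (Suc n) + q * horadam a b p q n"

definition bc_horadam :: "int \<Rightarrow> int \<Rightarrow> int \<Rightarrow> int \<Rightarrow> nat \<Rightarrow> bicomplex" where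
  "bc_horadam a b p q n =
     of_int (horadam a b p q n) + of_int (horadam a b p q (n + 1)) * bc_i
     + of_int (horadam a b p q (n + 2)) * bc_j + of_int (horadam a b p q (n + 3)) * bc_k"

(* For z in C the product z * i is taken in C, as bc_i = of_complex \<i>. *)
definition bc_underline :: "complex \<Rightarrow> bicomplex" where
  "bc_underline z = 1 + of_complex z * bc_i + of_complex (z ^ 2) * bc_j + of_complex (z ^ 3) * bc_k"

(* csqrt is the principal root: the real root of a nonnegative discriminant,
   and \<i> * sqrt (-D) for a negative discriminant D. *)
definition horadam_alpha :: "int \<Rightarrow> int \<Rightarrow> complex" where
  "horadam_alpha p q = (of_int p + csqrt (of_int (p ^ 2 + 4 * q))) / 2"

definition horadam_beta :: "int \<Rightarrow> int \<Rightarrow> complex" where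
  "horadam_beta p q = (of_int p - csqrt (of_int (p ^ 2 + 4 * q))) / 2"

end

theory Submission imports Defs begin

text \<open>
  With \<open>X n\<close> the bicomplex Horadam numbers, the quantity \<open>X (n+1)\<^sup>2 - X (n+2) X n\<close> is multiplied
  by \<open>-q\<close> when \<open>n\<close> increases by one, and at \<open>n = 0\<close> it equals
  \<open>X 1\<^sup>2 - p X 1 X 0 - q X 0\<^sup>2 = (X 1 - \<beta> X 0) (X 1 - \<alpha> X 0)\<close>. Since \<open>w (m+1) - \<beta> w m = A \<alpha>^m\<close>, the first
  factor is \<open>A \<alpha>\<close>-underlined, and symmetrically for the second. Unlike Binet's formula this needs
  no division by \<open>\<alpha> - \<beta>\<close>, so a double root is not a special case.
\<close>

lemma linear_recurrence_cassini:
  fixes X :: "nat \<Rightarrow> 'a :: comm_ring_1"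
  assumes rec: "\<And>n. X (Suc (Suc n)) = P * X (Suc n) + Q * X n"
  shows "(X (Suc n))\<^sup>2 - X (Suc (Suc n)) * X n
         = ((X 1)\<^sup>2 - P * X 1 * X 0 - Q * (X 0)\<^sup>2) * (- Q) ^ n"
proof (induction n)
  case 0
  show ?case
    by (simp add: rec algebra_simps power2_eq_square)
next
  case (Suc n)
  \<comment> \<open>Expanding one factor of the square and \<open>X (Suc (Suc (Suc n)))\<close> by
    the recurrence, the two \<open>P\<close> terms cancel.\<close>
  have "(X (Suc (Suc n)))\<^sup>2 - X (Suc (Suc (Suc n))) * X (Suc n)
        = - Q * ((X (Suc n))\<^sup>2 - X (Suc (Suc n)) * X n)"
    by (simp add: rec algebra_simps power2_eq_square)
  then show ?case
    unfolding Suc.IH by (simp add: algebra_simps)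
qed

lemma horadam_alpha_plus_beta: "horadam_alpha p q + horadam_beta p q = of_int p"
  by (simp add: horadam_alpha_def horadam_beta_def field_simps)

lemma horadam_alpha_times_beta: "horadam_alpha p q * horadam_beta p q = - of_int q"
proof -
  define s where "s = csqrt (of_int (p ^ 2 + 4 * q))"
  \<comment> \<open>Only the square of the root matters, so the sign of the discriminant is
    irrelevant.\<close>
  have "s\<^sup>2 = (of_int p)\<^sup>2 + 4 * of_int q"
    by (simp add: s_def)
  then show ?thesis
    unfolding horadam_alpha_def horadam_beta_def s_def[symmetric]
    by (simp add: field_simps power2_eq_square)
qed

text \<open>By Vieta, the recurrence has coefficients \<open>r + s\<close> and
  \<open>- (r * s)\<close>, so subtracting \<open>s\<close> times the previous term leaves a
  geometric sequence of ratio \<open>r\<close>. Either root may play \<open>s\<close>.\<close>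

lemma horadam_minus_root:
  fixes r s :: "'a :: comm_ring_1"
  assumes "r + s = of_int p" "r * s = - of_int q"
  shows "of_int (horadam a b p q (Suc n)) - s * of_int (horadam a b p q n)
         = (of_int b - of_int a * s) * r ^ n"
proof (induction n)
  case 0
  show ?case by (simp add: mult.commute)
next
  case (Suc n)
  have q: "of_int q = - (r * s)"
    using assms(2) by simp
  have "of_int (horadam a b p q (Suc (Suc n))) - s * of_int (horadam a b p q (Suc n))
        = r * (of_int (horadam a b p q (Suc n)) - s * of_int (horadam a b p q n))"
    by (simp add: assms(1)[symmetric] q algebra_simps)
  then show ?case
    unfolding Suc.IH by (simp add: algebra_simps)
qed

lemma of_complex_of_int [simp]: "of_complex (of_int m) = of_int m"
proof -
  have "of_complex (of_nat k) = of_nat k" for k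
    by (induction k) simp_all
  then show ?thesis
    by (cases m rule: int_diff_cases) simp
qed

lemma bc_horadam_rec:
  "bc_horadam a b p q (Suc (Suc n)) = of_int p * bc_horadam a b p q (Suc n) + of_int q * bc_horadam a b p q n"
  by (simp add: bc_horadam_def numeral_eq_Suc algebra_simps)

lemma bc_horadam_minus_root:
  assumes "r + s = of_int p" "r * s = - of_int q"
  shows "bc_horadam a b p q 1 - of_complex s * bc_horadam a b p q 0
         = of_complex (of_int b - of_int a * s) * bc_underline r"
proof -
  have w: "of_int (horadam a b p q (Suc n)) - of_complex s * of_int (horadam a b p q n)
           = of_complex (of_int b - of_int a * s) * of_complex (r ^ n)" for n
    using arg_cong[OF horadam_minus_root[OF assms, of a b n], of of_complex] by simp
  let ?w = "horadam a b p q" and ?s = "of_complex s"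
  have "bc_horadam a b p q 1 - ?s * bc_horadam a b p q 0
        = (of_int (?w (Suc 0)) - ?s * of_int (?w 0))
          + (of_int (?w (Suc 1)) - ?s * of_int (?w 1)) * bc_i
          + (of_int (?w (Suc 2)) - ?s * of_int (?w 2)) * bc_j
          + (of_int (?w (Suc 3)) - ?s * of_int (?w 3)) * bc_k"
    \<comment> \<open>The recurrence must stay folded here: the four coefficients are regrouped as
      differences to which \<open>w\<close> applies.\<close>
    by (simp add: bc_horadam_def numeral_eq_Suc algebra_simps del: horadam.simps)
  then show ?thesis
    unfolding w by (simp add: bc_underline_def algebra_simps)
qed

theorem theorem3p4:
  fixes a b p q :: int and \<alpha> \<beta> A B :: complex and n :: nat
  assumes "\<alpha> = horadam_alpha p q" and "\<beta> = horadam_beta p q"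
    and "A = of_int b - of_int a * \<beta>" and "B = of_int b - of_int a * \<alpha>"
    and "n \<ge> 1"
  shows "(bc_horadam a b p q n)\<^sup>2 - bc_horadam a b p q (n + 1) * bc_horadam a b p q (n - 1)
         = of_complex A * of_complex B * bc_underline \<alpha> * bc_underline \<beta> * (- of_int q) ^ (n - 1)"
proof -
  let ?X = "bc_horadam a b p q"
  have sum: "\<alpha> + \<beta> = of_int p" and prod: "\<alpha> * \<beta> = - of_int q"
    using assms(1,2) horadam_alpha_plus_beta horadam_alpha_times_beta by auto
  have p: "of_int p = of_complex \<alpha> + of_complex \<beta>"
    using arg_cong[OF sum, of of_complex] by simp
  have q: "of_int q = - (of_complex \<alpha> * of_complex \<beta>)"
    using arg_cong[OF prod, of of_complex] by simp
  have A: "?X 1 - of_complex \<beta> * ?X 0 = of_complex A * bc_underline \<alpha>"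
    unfolding assms(3) by (rule bc_horadam_minus_root[OF sum prod])
  have B: "?X 1 - of_complex \<alpha> * ?X 0 = of_complex B * bc_underline \<beta>"
    \<comment> \<open>The same lemma with the two roots exchanged.\<close>
    unfolding assms(4) using sum prod by (intro bc_horadam_minus_root) (simp_all add: ac_simps)
  have "(?X 1)\<^sup>2 - of_int p * ?X 1 * ?X 0 - of_int q * (?X 0)\<^sup>2
        = (?X 1 - of_complex \<beta> * ?X 0) * (?X 1 - of_complex \<alpha> * ?X 0)"
    unfolding p q by (simp add: algebra_simps power2_eq_square)
  also have "\<dots> = of_complex A * of_complex B * bc_underline \<alpha> * bc_underline \<beta>"
    unfolding A B by (simp add: ac_simps)
  finally have start: "(?X 1)\<^sup>2 - of_int p * ?X 1 * ?X 0 - of_int q * (?X 0)\<^sup>2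
        = of_complex A * of_complex B * bc_underline \<alpha> * bc_underline \<beta>" .
  \<comment> \<open>The Cassini identity is centred at \<open>Suc m\<close>, so its exponent
    \<open>m\<close> is \<open>n - 1\<close>.\<close>
  obtain m where "n = Suc m"
    using assms(5) by (cases n) auto
  with linear_recurrence_cassini[of ?X, OF bc_horadam_rec, of m, unfolded start]
  show ?thesis by simp
qed

end
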